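(* There is an instance of the online stochastic matching problem in which no algorithm can achieve an expected approximation factor better than $26 \over 27$. Moreover, there exists a family of instances with $n\rightarrow \infty$ for which no algorithm can achieve an expected approximation of $1-o(1)$.
   Context: Online stochastic matching in the i.i.d. model: we are given a bipartite graph $G=(A,I,E)$ between advertisers $A$ and impression types $I$, and for each $i\in I$ an integer $e_i$ (expected number of impressions of type $i$); let $n=\sum_i e_i$ and let $D$ be the distribution on $I$ with $\Pr[i]=e_i/n$. The algorithm has offline access to $G$ and $D$. Online, $n$ i.i.d. draws $i\sim D$ arrive, and each arriving impression must immediately be assigned to some advertiser $a$ with $(a,i)\in E$, or left unassigned; each advertiser may be assigned at most once. The goal is to maximize the number of assigned impressions. For a scenario $X$ (the multiset of drawn impressions), $\mathrm{OPT}(X)$ is the maximum matching in the realization graph between $A$ and the drawn impressions (each drawn copy of $i$ adjacent to the neighbors of $i$). The expected approximation factor of an (possibly randomized) online algorithm $\mathrm{ALG}$ on an instance is $E[\mathrm{ALG}(X)/\mathrm{OPT}(X)]$, the expectation over scenarios $X$ (and the algorithm's randomness). *)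

theory Defs
  imports "HOL-Probability.Probability" "HOL-Library.Landau_Symbols"
begin

record ('a, 'i) osm_instance =
  advertisers :: "'a set"
  impressions :: "'i set"
  edges :: "('a \<times> 'i) set"
  expected :: "'i \<Rightarrow> nat"

definition num_draws :: "('a, 'i) osm_instance \<Rightarrow> nat" where
  "num_draws G = (\<Sum>i\<in>impressions G. expected G i)"

text \<open>Without draws the distribution on impression types is undefined.\<close>

definition valid_instance :: "('a, 'i) osm_instance \<Rightarrow> bool" where
  "valid_instance G \<longleftrightarrow>
     finite (advertisers G) \<and> finite (impressions G) \<and>
     edges G \<subseteq> advertisers G \<times> impressions G \<and> num_draws G > 0"

definition type_pmf :: "('a, 'i) osm_instance \<Rightarrow> 'i pmf" where
  "type_pmf G =
     embed_pmf (\<lambda>i. if i \<in> impressions G then real (expected G i) / real (num_draws G) else 0)"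

lemma pmf_type_pmf:
  assumes "valid_instance G"
  shows "pmf (type_pmf G) i =
    (if i \<in> impressions G then real (expected G i) / real (num_draws G) else 0)"
  unfolding type_pmf_def
proof (rule pmf_embed_pmf)
  let ?f = "\<lambda>i. if i \<in> impressions G then real (expected G i) / real (num_draws G) else 0"
  have fin: "finite (impressions G)" and pos: "num_draws G > 0"
    using assms by (auto simp: valid_instance_def)
  show "0 \<le> ?f x" for x by simp
  have "(\<integral>\<^sup>+x. ennreal (?f x) \<partial>count_space UNIV) = (\<Sum>x\<in>impressions G. ennreal (?f x))"
    by (rule nn_integral_count_space') (use fin in auto)
  also have "\<dots> = ennreal (\<Sum>x\<in>impressions G. ?f x)"
    by (rule sum_ennreal) simp
  also have "(\<Sum>x\<in>impressions G. ?f x) = real (num_draws G) / real (num_draws G)"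
    by (simp add: num_draws_def flip: sum_divide_distrib)
  finally show "(\<integral>\<^sup>+x. ennreal (?f x) \<partial>count_space UNIV) = 1"
    using pos by simp
qed

text \<open>A scenario is kept as the list of draws in order of arrival.\<close>

definition scenario_pmf :: "('a, 'i) osm_instance \<Rightarrow> 'i list pmf" where
  "scenario_pmf G = replicate_pmf (num_draws G) (type_pmf G)"

text \<open>The realization graph joins advertisers to arrival positions, so that repeated
  draws of one type are different vertices.\<close>

definition realization :: "('a, 'i) osm_instance \<Rightarrow> 'i list \<Rightarrow> ('a \<times> nat) set" where
  "realization G X = {(a, t). t < length X \<and> (a, X ! t) \<in> edges G}"

definition is_matching :: "('a \<times> nat) set \<Rightarrow> ('a \<times> nat) set \<Rightarrow> bool" where
  "is_matching R M \<longleftrightarrow> M \<subseteq> R \<and> inj_on fst M \<and> inj_on snd M"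

definition OPT :: "('a, 'i) osm_instance \<Rightarrow> 'i list \<Rightarrow> nat" where
  "OPT G X = Max (card ` {M. is_matching (realization G X) M})"

text \<open>A deterministic online policy decides on an arrival from the list of all arrivals up to
  and including it; its own earlier decisions are functions of shorter prefixes.\<close>

type_synonym ('a, 'i) policy = "'i list \<Rightarrow> 'a option"

definition assignment :: "('a, 'i) policy \<Rightarrow> 'i list \<Rightarrow> ('a \<times> nat) set" where
  "assignment p X = {(a, t). t < length X \<and> p (take (Suc t) X) = Some a}"

definition feasible_policy :: "('a, 'i) osm_instance \<Rightarrow> ('a, 'i) policy \<Rightarrow> bool" where
  "feasible_policy G p \<longleftrightarrow>
     (\<forall>X. length X = num_draws G \<and> set X \<subseteq> impressions G \<longrightarrow>
        is_matching (realization G X) (assignment p X))"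

text \<open>A randomized algorithm, given the instance, draws a deterministic policy before the first
  arrival. Discrete distributions suffice, since on a given instance only finitely many
  prefixes, and finitely many decisions on each of them, are relevant.\<close>

type_synonym ('a, 'i) algorithm = "('a, 'i) osm_instance \<Rightarrow> ('a, 'i) policy pmf"

definition online_algorithm :: "('a, 'i) algorithm \<Rightarrow> bool" where
  "online_algorithm ALG \<longleftrightarrow>
     (\<forall>G. valid_instance G \<longrightarrow> (\<forall>p\<in>set_pmf (ALG G). feasible_policy G p))"

text \<open>A scenario with optimum 0 counts as solved optimally. With the convention
  \<open>0 / 0 = 0\<close> an instance without edges would have factor 0.\<close>

definition ratio :: "('a, 'i) osm_instance \<Rightarrow> ('a, 'i) policy \<Rightarrow> 'i list \<Rightarrow> real" where
  "ratio G p X =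
     (if OPT G X = 0 then 1 else real (card (assignment p X)) / real (OPT G X))"

definition approx_factor :: "('a, 'i) algorithm \<Rightarrow> ('a, 'i) osm_instance \<Rightarrow> real" where
  "approx_factor ALG G =
     measure_pmf.expectation (pair_pmf (ALG G) (scenario_pmf G)) (\<lambda>(p, X). ratio G p X)"

end

theory Submission
  imports Defs "HOL-Real_Asymp.Real_Asymp"
begin

text \<open>The graph is the 6-cycle: impression types \<open>0, 1, 2\<close> with one expected impression each, where
  type \<open>i\<close> is adjacent to the two advertisers other than \<open>i\<close>. Adding an isolated type \<open>3\<close> with \<open>k\<close>
  expected impressions makes \<open>n = k + 3\<close> arbitrarily large, and the probability of exactly three
  draws from the 6-cycle stays bounded away from \<open>0\<close>. When the first draw from the cycle has
  type \<open>i\<close> and is given to advertiser \<open>a\<close>, it may be followed by two draws of the third type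
  \<open>j \<noteq> i, a\<close>. These now compete for the single advertiser \<open>i\<close>, while the optimum is 3. Hence for
  every set of three positions and each of the three types \<open>i\<close> there is a scenario, of probability
  \<open>(1 / n)^3 * (k / n)^k\<close>, on which the ratio is at most \<open>2/3\<close>. So the expected loss is at least
  \<open>(n choose 3) / n^3 * (k / n)^k\<close>, which is \<open>1/27\<close> for \<open>k = 0\<close> (as \<open>0 ^ 0 = 1\<close>) and tends to
  \<open>exp (-3) / 6\<close> as \<open>k\<close> grows.\<close>

section \<open>Scenario probabilities and general bounds on the ratio\<close>

lemma pmf_replicate_pmf:
  assumes "length xs = n"
  shows "pmf (replicate_pmf n p) xs = (\<Prod>x\<leftarrow>xs. pmf p x)"
  using assms
proof (induction n arbitrary: xs)
  case 0
  then show ?case by simp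
next
  case (Suc n)
  then obtain y ys where xs: "xs = y # ys" and len: "length ys = n"
    by (cases xs) auto
  have "replicate_pmf (Suc n) p = map_pmf (\<lambda>(x, xs). x # xs) (pair_pmf p (replicate_pmf n p))"
    by (simp add: pair_pmf_def map_bind_pmf)
  moreover have "pmf (map_pmf (\<lambda>(x, xs). x # xs) (pair_pmf p (replicate_pmf n p)))
      ((\<lambda>(x, xs). x # xs) (y, ys)) = pmf (pair_pmf p (replicate_pmf n p)) (y, ys)"
    by (rule pmf_map_inj') (auto simp: inj_on_def)
  ultimately show ?case
    using Suc.IH[OF len] by (simp add: xs pmf_pair)
qed

lemma finite_realization:
  assumes "valid_instance G"
  shows "finite (realization G X)"
proof -
  have "realization G X \<subseteq> advertisers G \<times> {..<length X}"
    using assms by (auto simp: valid_instance_def realization_def)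
  then show ?thesis
    using assms finite_subset by (fastforce simp: valid_instance_def)
qed

lemma card_le_OPT:
  assumes "valid_instance G" "is_matching (realization G X) M"
  shows "card M \<le> OPT G X"
proof -
  have "finite {M. is_matching (realization G X) M}"
    by (rule finite_subset[of _ "Pow (realization G X)"])
      (auto simp: is_matching_def finite_realization assms)
  then show ?thesis
    unfolding OPT_def using assms by (intro Max_ge) auto
qed

lemma set_scenario_pmf:
  assumes "valid_instance G" "X \<in> set_pmf (scenario_pmf G)"
  shows "length X = num_draws G" "set X \<subseteq> impressions G"
proof -
  have "set_pmf (type_pmf G) \<subseteq> impressions G"
    by (auto simp: set_pmf_eq pmf_type_pmf[OF assms(1)] split: if_splits)
  with assms(2) show "length X = num_draws G" "set X \<subseteq> impressions G"
    by (auto simp: scenario_pmf_def set_replicate_pmf lists_eq_set)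
qed

lemma ratio_nonneg: "0 \<le> ratio G p X"
  by (simp add: ratio_def)

lemma ratio_le_1:
  assumes "valid_instance G" "feasible_policy G p" "X \<in> set_pmf (scenario_pmf G)"
  shows "ratio G p X \<le> 1"
proof -
  have "is_matching (realization G X) (assignment p X)"
    using assms(2) set_scenario_pmf[OF assms(1,3)] by (simp add: feasible_policy_def)
  then show ?thesis
    using card_le_OPT[OF assms(1)] by (auto simp: ratio_def divide_simps)
qed

text \<open>Reduction to deterministic policies: a randomized algorithm is a mixture of feasible
  policies drawn independently of the scenario, so a loss that each of them incurs with probability
  at least \<open>q\<close> survives averaging.\<close>

lemma approx_factor_le:
  fixes ALG :: "('a, 'i) algorithm"
  assumes G: "valid_instance G" and ALG: "online_algorithm ALG" and "d \<ge> 0" "q \<ge> 0"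
    and loss: "\<And>p. feasible_policy G p \<Longrightarrow>
      q \<le> measure_pmf.prob (scenario_pmf G) {X. ratio G p X \<le> 1 - d}"
  shows "approx_factor ALG G \<le> 1 - d * q"
proof -
  let ?P = "pair_pmf (ALG G) (scenario_pmf G)"
  define Q where "Q = {(p, X). ratio G p X \<le> 1 - d}"
  have feas: "feasible_policy G p" if "p \<in> set_pmf (ALG G)" for p
    using ALG G that by (auto simp: online_algorithm_def)
  have bnd: "ratio G p X \<le> 1" if "(p, X) \<in> set_pmf ?P" for p X
    using that ratio_le_1[OF G] feas by auto
  have "ennreal q = (\<integral>\<^sup>+p. ennreal q \<partial>ALG G)"
    by simp
  also have "\<dots> \<le> (\<integral>\<^sup>+p. emeasure (scenario_pmf G) {X. ratio G p X \<le> 1 - d} \<partial>ALG G)"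
    by (intro nn_integral_mono_AE)
      (auto simp: AE_measure_pmf_iff measure_pmf.emeasure_eq_measure intro!: ennreal_leI loss feas)
  also have "\<dots> = (\<integral>\<^sup>+p. \<integral>\<^sup>+X. indicator Q (p, X) \<partial>scenario_pmf G \<partial>ALG G)"
  proof (rule nn_integral_cong)
    fix p
    have "(\<integral>\<^sup>+X. indicator Q (p, X) \<partial>scenario_pmf G) =
        (\<integral>\<^sup>+X. indicator {X. ratio G p X \<le> 1 - d} X \<partial>scenario_pmf G)"
      by (simp add: Q_def indicator_def)
    then show "emeasure (scenario_pmf G) {X. ratio G p X \<le> 1 - d} =
        (\<integral>\<^sup>+X. indicator Q (p, X) \<partial>scenario_pmf G)"
      by simp
  qed
  also have "\<dots> = emeasure ?P Q"
    by (simp add: nn_integral_pair_pmf'[symmetric])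
  finally have q: "q \<le> measure_pmf.prob ?P Q"
    by (simp add: measure_pmf.emeasure_eq_measure)
  \<comment> \<open>On \<open>Q\<close> the ratio is at most \<open>1 - d\<close>; elsewhere
    feasibility still bounds it by \<open>1\<close>.\<close>
  have "approx_factor ALG G \<le> (\<integral>x. 1 - d * indicator Q x \<partial>?P)"
    unfolding approx_factor_def
  proof (rule integral_mono_AE)
    show "integrable ?P (\<lambda>(p, X). ratio G p X)"
      by (rule measure_pmf.integrable_const_bound[where B = 1])
        (use bnd in \<open>auto simp: AE_measure_pmf_iff ratio_nonneg\<close>)
    show "integrable ?P (\<lambda>x. 1 - d * indicator Q x)"
      by (intro Bochner_Integration.integrable_diff integrable_mult_right)
        (auto intro: integrable_real_indicator simp: measure_pmf.emeasure_eq_measure)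
    show "AE x in ?P. (case x of (p, X) \<Rightarrow> ratio G p X) \<le> 1 - d * indicator Q x"
      using bnd by (auto simp: AE_measure_pmf_iff Q_def indicator_def)
  qed
  also have "\<dots> = 1 - d * measure_pmf.prob ?P Q"
    by (subst Bochner_Integration.integral_diff)
      (auto intro!: integrable_mult_right integrable_real_indicator
        simp: measure_pmf.emeasure_eq_measure)
  also have "\<dots> \<le> 1 - d * q"
    using q \<open>d \<ge> 0\<close> by (simp add: mult_left_mono)
  finally show ?thesis .
qed

section \<open>The padded 6-cycle and its hard scenarios\<close>

text \<open>For \<open>k = 0\<close> type \<open>3\<close> remains an impression type of probability
  \<open>0\<close>, so the bare cycle belongs to the same family.\<close>

definition six_cycle :: "nat \<Rightarrow> (nat, nat) osm_instance" where
  "six_cycle k = \<lparr>advertisers = {..<3}, impressions = {..<4},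
     edges = {(a, i). a < 3 \<and> i < 3 \<and> a \<noteq> i}, expected = (\<lambda>i. if i < 3 then 1 else k)\<rparr>"

definition cycle_scenario :: "nat \<Rightarrow> nat set \<Rightarrow> nat \<Rightarrow> nat \<Rightarrow> nat list" where
  "cycle_scenario n B i j =
     map (\<lambda>t. if t \<in> B then if t = Min B then i else j else 3) [0..<n]"

lemma num_draws_six_cycle [simp]: "num_draws (six_cycle k) = k + 3"
  by (simp add: num_draws_def six_cycle_def numeral_eq_Suc lessThan_Suc)

lemma valid_six_cycle: "valid_instance (six_cycle k)"
  unfolding valid_instance_def num_draws_six_cycle by (auto simp: six_cycle_def)

lemma edges_six_cycle: "(a, i) \<in> edges (six_cycle k) \<longleftrightarrow> a < 3 \<and> i < 3 \<and> a \<noteq> i"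
  by (simp add: six_cycle_def)

lemma length_cycle_scenario [simp]: "length (cycle_scenario n B i j) = n"
  by (simp add: cycle_scenario_def)

lemma nth_cycle_scenario:
  "t < n \<Longrightarrow> cycle_scenario n B i j ! t = (if t \<in> B then if t = Min B then i else j else 3)"
  by (simp add: cycle_scenario_def)

text \<open>The type \<open>j\<close> shows only after position \<open>Min B\<close>, so an online
  policy decides on the first cycle draw without knowing \<open>j\<close>.\<close>

lemma take_cycle_scenario:
  assumes "t \<le> Suc (Min B)" "t \<le> n" "finite B"
  shows "take t (cycle_scenario n B i j) = take t (cycle_scenario n B i j')"
proof (rule nth_equalityI)
  fix s assume "s < length (take t (cycle_scenario n B i j))"
  then have "s < t" "s < n" using assms by auto
  moreover have "s = Min B" if "s \<in> B"
    using Min_le[OF \<open>finite B\<close> that] \<open>s < t\<close> assms by linarith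
  ultimately show "take t (cycle_scenario n B i j) ! s = take t (cycle_scenario n B i j') ! s"
    by (auto simp: nth_cycle_scenario)
qed auto

text \<open>Only the earliest position is singled out: the other two will carry the same type, so
  their order does not matter.\<close>

lemma card_3_Min:
  fixes B :: "nat set"
  assumes "card B = 3"
  obtains s t u where "B = {s, t, u}" "s < t" "s < u" "t \<noteq> u" "Min B = s"
proof -
  have fin: "finite B" and ne: "B \<noteq> {}"
    using assms card.infinite by fastforce+
  let ?s = "Min B"
  have s: "?s \<in> B" using fin ne by simp
  then have "card (B - {?s}) = 2"
    using assms fin by simp
  then obtain t u where tu: "B - {?s} = {t, u}" "t \<noteq> u"
    by (auto simp: card_2_iff)
  then have mem: "t \<in> B" "u \<in> B" "t \<noteq> ?s" "u \<noteq> ?s" by auto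
  then have "?s < t" "?s < u"
    using Min_le[OF fin] by (auto simp: order_less_le)
  with tu s show ?thesis
    by (intro that[of ?s t u]) auto
qed

lemma OPT_cycle_scenario:
  assumes "B \<subseteq> {..<n}" "card B = 3" "i < 3" "j < 3" "j \<noteq> i"
  shows "OPT (six_cycle k) (cycle_scenario n B i j) \<ge> 3"
proof -
  obtain s t u where B: "B = {s, t, u}" "s < t" "s < u" "t \<noteq> u" "Min B = s"
    using card_3_Min[OF assms(2)] .
  have "\<exists>a<3. a \<noteq> i \<and> a \<noteq> j"
    using assms(3-5) by presburger
  then obtain a where a: "a < 3" "a \<noteq> i" "a \<noteq> j" by auto
  \<comment> \<open>Giving \<open>j\<close> to the first draw keeps both neighbours \<open>i\<close>
    and \<open>a\<close> of type \<open>j\<close> free for the two later draws.\<close>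
  let ?M = "{(j, s), (i, t), (a, u)}"
  have "is_matching (realization (six_cycle k) (cycle_scenario n B i j)) ?M"
    using assms a B
    by (auto simp: is_matching_def realization_def edges_six_cycle nth_cycle_scenario inj_on_def)
  from card_le_OPT[OF valid_six_cycle this] show ?thesis
    using a B assms by auto
qed

lemma loss_cycle_scenario:
  assumes p: "feasible_policy (six_cycle k) p"
    and B: "B \<subseteq> {..<k + 3}" "card B = 3" and i: "i < 3"
  shows "\<exists>j<3. j \<noteq> i \<and> ratio (six_cycle k) p (cycle_scenario (k + 3) B i j) \<le> 1 - 1 / 3"
proof -
  obtain s t u where stu: "B = {s, t, u}" "s < t" "s < u" "t \<noteq> u" "Min B = s"
    using card_3_Min[OF B(2)] .
  have less: "s < k + 3" "t < k + 3" "u < k + 3" using B stu by auto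
  \<comment> \<open>The \<open>0\<close> is an arbitrary stand-in for the type not yet
    revealed.\<close>
  define pre where "pre = take (Suc s) (cycle_scenario (k + 3) B i 0)"
  have pre: "take (Suc s) (cycle_scenario (k + 3) B i j) = pre" for j
    unfolding pre_def by (rule take_cycle_scenario) (use stu less in auto)
  \<comment> \<open>The adversary's choice: at most two of the three values are excluded.\<close>
  have "\<exists>j<3. j \<noteq> i \<and> (\<forall>a. p pre = Some a \<longrightarrow> j \<noteq> a)"
  proof (cases "p pre")
    case None
    moreover have "\<exists>j<3. j \<noteq> i" using i by presburger
    ultimately show ?thesis by simp
  next
    case (Some a)
    have "\<exists>j<3. j \<noteq> i \<and> j \<noteq> a" using i by presburger
    with Some show ?thesis by auto
  qed
  then obtain j where j: "j < 3" "j \<noteq> i" and ja: "\<And>a. p pre = Some a \<Longrightarrow> j \<noteq> a"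
    by blast
  let ?X = "cycle_scenario (k + 3) B i j"
  let ?A = "assignment p ?X"
  have "set ?X \<subseteq> {..<4}"
    using i j by (auto simp: cycle_scenario_def)
  then have M: "is_matching (realization (six_cycle k) ?X) ?A"
    using p by (simp add: feasible_policy_def six_cycle_def[of k, THEN arg_cong, of impressions])
  then have inj: "inj_on fst ?A" "inj_on snd ?A"
    and edge: "\<And>a x. (a, x) \<in> ?A \<Longrightarrow> x < k + 3 \<and> (a, ?X ! x) \<in> edges (six_cycle k)"
    by (auto simp: is_matching_def realization_def)
  have sndB: "snd ` ?A \<subseteq> B"
    using edge by (fastforce simp: nth_cycle_scenario edges_six_cycle split: if_splits)
  have fstj: "fst ` ?A \<subseteq> {..<3}"
    using edge by (auto simp: edges_six_cycle)
  \<comment> \<open>Advertiser \<open>j\<close> is not adjacent to type \<open>j\<close>, so it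
    could serve only position \<open>s\<close>, where the policy did not use it. Two advertisers
    remain.\<close>
  have "j \<notin> fst ` ?A"
  proof
    assume "j \<in> fst ` ?A"
    then obtain x where x: "(j, x) \<in> ?A" by auto
    then have "x \<in> B" using sndB by force
    moreover have "x \<noteq> s"
      using x ja pre by (auto simp: assignment_def)
    ultimately have "?X ! x = j"
      using stu less by (auto simp: nth_cycle_scenario)
    then show False using edge[OF x] by (simp add: edges_six_cycle)
  qed
  then have "card (fst ` ?A) \<le> card ({..<3} - {j})"
    using fstj by (intro card_mono) auto
  then have "card ?A \<le> 2"
    using j by (simp add: card_image[OF inj(1)])
  moreover have "OPT (six_cycle k) ?X \<ge> 3"
    by (rule OPT_cycle_scenario) (use B i j in auto)
  ultimately have "ratio (six_cycle k) p ?X \<le> 1 - 1 / 3"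
    by (auto simp: ratio_def divide_simps)
  with j show ?thesis by auto
qed

text \<open>The value does not depend on \<open>B\<close>, \<open>i\<close> or \<open>j\<close>, so
  the probability of a set of such scenarios is found by counting.\<close>

lemma pmf_cycle_scenario:
  assumes "B \<subseteq> {..<k + 3}" "card B = 3" "i < 3" "j < 3"
  shows "pmf (scenario_pmf (six_cycle k)) (cycle_scenario (k + 3) B i j) =
    (1 / real (k + 3)) ^ 3 * (real k / real (k + 3)) ^ k"
proof -
  let ?n = "k + 3"
  have pmf: "pmf (type_pmf (six_cycle k)) x =
      (if x < 3 then 1 / real ?n else if x = 3 then real k / real ?n else 0)" for x
    unfolding pmf_type_pmf[OF valid_six_cycle] num_draws_six_cycle by (auto simp: six_cycle_def)
  have "pmf (scenario_pmf (six_cycle k)) (cycle_scenario ?n B i j) =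
      (\<Prod>x\<leftarrow>cycle_scenario ?n B i j. pmf (type_pmf (six_cycle k)) x)"
    unfolding scenario_pmf_def by (rule pmf_replicate_pmf) simp
  also have "\<dots> = (\<Prod>t\<leftarrow>[0..<?n]. if t \<in> B then 1 / real ?n else real k / real ?n)"
    unfolding cycle_scenario_def map_map
    by (intro arg_cong[of _ _ prod_list] map_cong) (use assms in \<open>auto simp: pmf\<close>)
  also have "\<dots> = (\<Prod>t<?n. if t \<in> B then 1 / real ?n else real k / real ?n)"
    by (subst prod.distinct_set_conv_list[symmetric]) (auto simp: atLeast0LessThan)
  also have "\<dots> = (1 / real ?n) ^ card B * (real k / real ?n) ^ card ({..<?n} - B)"
    using assms(1) by (simp add: prod.If_cases Int_absorb1 Diff_eq)
  also have "card ({..<?n} - B) = k"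
    using assms(1,2) by (subst card_Diff_subset) (auto intro: finite_subset)
  finally show ?thesis by (simp only: assms(2))
qed

section \<open>The total loss and its limit\<close>

lemma approx_factor_six_cycle:
  assumes "online_algorithm ALG"
  shows "approx_factor ALG (six_cycle k) \<le>
    1 - real (k + 3 choose 3) / real (k + 3) ^ 3 * (real k / real (k + 3)) ^ k"
proof -
  let ?n = "k + 3"
  let ?S = "{B. B \<subseteq> {..<?n} \<and> card B = 3}"
  let ?w = "(1 / real ?n) ^ 3 * (real k / real ?n) ^ k"
  \<comment> \<open>The factor \<open>3\<close> counts the types \<open>i\<close> of the first cycle
    draw; it later cancels against the loss of \<open>1 / 3\<close> per bad scenario.\<close>
  have "3 * real (?n choose 3) * ?w \<le>
      measure_pmf.prob (scenario_pmf (six_cycle k)) {X. ratio (six_cycle k) p X \<le> 1 - 1 / 3}"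
    if p: "feasible_policy (six_cycle k) p" for p
  proof -
    obtain J where J: "\<And>B i. B \<in> ?S \<Longrightarrow> i < 3 \<Longrightarrow> J B i < 3 \<and> J B i \<noteq> i \<and>
        ratio (six_cycle k) p (cycle_scenario ?n B i (J B i)) \<le> 1 - 1 / 3"
      using loss_cycle_scenario[OF p] by (simp only: mem_Collect_eq) metis
    let ?f = "\<lambda>(B, i). cycle_scenario ?n B i (J B i)"
    let ?D = "?S \<times> {..<3::nat}"
    \<comment> \<open>A scenario determines \<open>B\<close> and \<open>i\<close>, whatever
      \<open>J\<close> is, so different pairs give different scenarios and their probabilities add
      up.\<close>
    have recover: "B = {t. t < ?n \<and> ?f (B, i) ! t \<noteq> 3}" "i = ?f (B, i) ! Min B"
      if "B \<in> ?S" "i < 3" for B i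
    proof -
      have "finite B" "B \<noteq> {}" using that card.infinite by fastforce+
      then have "Min B \<in> B" by simp
      moreover have "t < ?n" if "t \<in> B" for t
        using that \<open>B \<in> ?S\<close> by auto
      moreover have "J B i < 3"
        using J[OF that] by simp
      ultimately show "B = {t. t < ?n \<and> ?f (B, i) ! t \<noteq> 3}" "i = ?f (B, i) ! Min B"
        using \<open>i < 3\<close> by (auto simp: nth_cycle_scenario split: if_splits)
    qed
    have inj: "inj_on ?f ?D"
    proof (intro inj_onI, clarify)
      fix B i B' i' assume *: "i < (3::nat)" "i' < (3::nat)" "B \<subseteq> {..<?n}" "card B = 3"
        "B' \<subseteq> {..<?n}" "card B' = 3" "cycle_scenario ?n B i (J B i) = cycle_scenario ?n B' i' (J B' i')"
      then have "B = B'"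
        using recover(1)[of B i] recover(1)[of B' i'] by simp
      with * show "B = B' \<and> i = i'"
        using recover(2)[of B i] recover(2)[of B' i'] by simp
    qed
    have fin: "finite ?D" by (auto intro: finite_subset[of _ "Pow {..<?n}"])
    have "3 * real (?n choose 3) * ?w = (\<Sum>x\<in>?D. ?w)"
      by (simp add: n_subsets)
    also have "\<dots> = (\<Sum>x\<in>?D. pmf (scenario_pmf (six_cycle k)) (?f x))"
      by (intro sum.cong) (use J in \<open>auto simp: pmf_cycle_scenario\<close>)
    also have "\<dots> = measure_pmf.prob (scenario_pmf (six_cycle k)) (?f ` ?D)"
      by (simp add: measure_measure_pmf_finite fin sum.reindex[OF inj] o_def)
    also have "\<dots> \<le> measure_pmf.prob (scenario_pmf (six_cycle k))
        {X. ratio (six_cycle k) p X \<le> 1 - 1 / 3}"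
      by (intro measure_pmf.finite_measure_mono) (use J in auto)
    finally show ?thesis .
  qed
  from approx_factor_le[OF valid_six_cycle assms _ _ this]
  have "approx_factor ALG (six_cycle k) \<le> 1 - 1 / 3 * (3 * real (?n choose 3) * ?w)"
    by simp
  then show ?thesis by (simp add: power_divide)
qed

text \<open>The first factor tends to \<open>1 / 6\<close>, and \<open>(k / (k + 3)) ^ k\<close>,
  which is \<open>(1 + 3 / k) ^ (-k)\<close> for positive \<open>k\<close>, tends to
  \<open>exp (-3)\<close>.\<close>

lemma cycle_loss_tendsto:
  "(\<lambda>k. real (k + 3 choose 3) / real (k + 3) ^ 3 * (real k / real (k + 3)) ^ k)
     \<longlonglongrightarrow> exp (-3) / 6"
proof -
  have "real (k + 3 choose 3) = real (k + 3) * real (k + 2) * real (k + 1) / 6" for k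
    by (subst binomial_altdef_of_nat) (auto simp: numeral_3_eq_3 numeral_2_eq_2 field_simps)
  then show ?thesis
    by (simp only:) real_asymp
qed

theorem theorem1:
  shows "(\<exists>G :: (nat, nat) osm_instance. valid_instance G \<and>
            (\<forall>ALG. online_algorithm ALG \<longrightarrow> approx_factor ALG G \<le> 26 / 27)) \<and>
         (\<exists>F :: nat \<Rightarrow> (nat, nat) osm_instance.
            (\<forall>k. valid_instance (F k)) \<and>
            filterlim (\<lambda>k. num_draws (F k)) at_top at_top \<and>
            (\<forall>ALG. online_algorithm ALG \<longrightarrow>
               \<not> (\<exists>\<epsilon> :: nat \<Rightarrow> real. \<epsilon> \<in> o(\<lambda>_. 1) \<and>
                    (\<forall>k. approx_factor ALG (F k) \<ge> 1 - \<epsilon> (num_draws (F k))))))"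
proof (intro conjI)
  show "\<exists>G :: (nat, nat) osm_instance. valid_instance G \<and>
      (\<forall>ALG. online_algorithm ALG \<longrightarrow> approx_factor ALG G \<le> 26 / 27)"
    \<comment> \<open>At \<open>k = 0\<close> the loss is
      \<open>1 / 3 ^ 3 * 0 ^ 0 = 1 / 27\<close>.\<close>
    using valid_six_cycle approx_factor_six_cycle[of _ 0] by (intro exI[of _ "six_cycle 0"]) auto
next
  have draws: "filterlim (\<lambda>k. num_draws (six_cycle k)) at_top at_top"
    unfolding num_draws_six_cycle
    by (rule filterlim_at_top_mono[OF filterlim_ident]) simp
  have False if ALG: "online_algorithm ALG" and small: "\<epsilon> \<in> o(\<lambda>_. 1)"
    and lower: "\<forall>k. approx_factor ALG (six_cycle k) \<ge> 1 - \<epsilon> (num_draws (six_cycle k))"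
    for ALG and \<epsilon> :: "nat \<Rightarrow> real"
  proof -
    have "\<epsilon> \<longlonglongrightarrow> 0"
      using smalloD_tendsto[OF small] by simp
    then have "(\<lambda>k. \<epsilon> (num_draws (six_cycle k))) \<longlonglongrightarrow> 0"
      using draws by (rule filterlim_compose)
    \<comment> \<open>The error term dominates the loss for every \<open>k\<close>, yet it tends to
      \<open>0\<close> while the loss has a positive limit.\<close>
    moreover have "real (k + 3 choose 3) / real (k + 3) ^ 3 * (real k / real (k + 3)) ^ k
        \<le> \<epsilon> (num_draws (six_cycle k))" for k
      using approx_factor_six_cycle[OF ALG, of k] lower[rule_format, of k] by linarith
    ultimately have "exp (-3) / 6 \<le> (0::real)"
      by (intro LIMSEQ_le[OF cycle_loss_tendsto]) auto
    then show False
      using exp_gt_zero[of "-3::real"] by linarith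
  qed
  with draws show "\<exists>F :: nat \<Rightarrow> (nat, nat) osm_instance.
      (\<forall>k. valid_instance (F k)) \<and>
      filterlim (\<lambda>k. num_draws (F k)) at_top at_top \<and>
      (\<forall>ALG. online_algorithm ALG \<longrightarrow>
         \<not> (\<exists>\<epsilon> :: nat \<Rightarrow> real. \<epsilon> \<in> o(\<lambda>_. 1) \<and>
              (\<forall>k. approx_factor ALG (F k) \<ge> 1 - \<epsilon> (num_draws (F k)))))"
    using valid_six_cycle by (intro exI[of _ six_cycle]) blast
qed

end
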